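(* There is an absolute constant $c>0$ such that the following holds. For any positive integer $n$ and any $\epsilon,\delta$ with $\frac{\log n}{n} < \epsilon < 10^{-6}$ and $0<\delta<0.1\epsilon$, every $(\epsilon,\delta)$-DP algorithm $\mathcal{A}$ taking integer partitions as input and outputting real sequences has error at least $c\sqrt{\frac{n}{\epsilon}\log\left(\frac{1}{\epsilon}\right)}$ for integer partitions of size at most $n$; i.e., there is no $(\epsilon,\delta)$-DP algorithm with error $o\left(\sqrt{\frac{n}{\epsilon}\log\left(\frac{1}{\epsilon}\right)}\right)$.
   Context: $\log$ denotes logarithm base 2. An integer partition is an infinite sequence $\mathbf{p}=(p_1,p_2,\dots)$ of non-negative integers with $p_1\ge p_2\ge\cdots$ and finite size $\sum_i p_i$; $\mathcal{I}_{\le n}$ is the set of integer partitions of size at most $n$. Distances are $\ell_1$ distances $\|\mathbf{v}-\mathbf{v}'\|_1=\sum_i|v_i-v'_i|$ (sequences padded with zeros). Two integer partitions are neighbors iff their $\ell_1$ distance is at most $1$. A randomized algorithm $\mathcal{A}$ is $(\epsilon,\delta)$-DP if for all neighboring inputs $\mathbf{p},\mathbf{p}'$ and all sets $S$ of outputs, $\Pr[\mathcal{A}(\mathbf{p})\in S]\le e^{\epsilon}\Pr[\mathcal{A}(\mathbf{p}')\in S]+\delta$. The error of $\mathcal{A}$ for integer partitions of size at most $n$ is $\max_{\mathbf{p}\in\mathcal{I}_{\le n}}\mathbb{E}[\|\mathcal{A}(\mathbf{p})-\mathbf{p}\|_1]$.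
   Formalization: The bound is stated for n ≥ 2 rather than every positive integer n: at n = 1 every 0 < ε < 10^-6 is allowed, and the algorithm that always outputs zero is private with error 1 while the claimed bound tends to infinity as ε tends to 0. *)

theory Defs
  imports "HOL-Probability.Probability"
begin

text \<open>Sequences are indexed from \<open>0\<close>, so the part \<open>p\<^sub>i\<close> of a partition is \<open>p (i - 1)\<close>.
  For sequences of naturals, having finite size is the same as having finite support.\<close>

definition int_partitions :: "(nat \<Rightarrow> nat) set" where
  "int_partitions = {p. antimono p \<and> finite {i. p i \<noteq> 0}}"

definition partition_size :: "(nat \<Rightarrow> nat) \<Rightarrow> nat" where
  "partition_size p = (\<Sum>i | p i \<noteq> 0. p i)"

definition int_partitions_le :: "nat \<Rightarrow> (nat \<Rightarrow> nat) set" where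
  "int_partitions_le n = {p \<in> int_partitions. partition_size p \<le> n}"

text \<open>The distance is extended-valued, since the difference of two real sequences need not be
  absolutely summable.\<close>

definition l1_dist :: "(nat \<Rightarrow> real) \<Rightarrow> (nat \<Rightarrow> real) \<Rightarrow> ennreal" where
  "l1_dist v w = (\<Sum>i. ennreal \<bar>v i - w i\<bar>)"

definition neighbors :: "(nat \<Rightarrow> nat) \<Rightarrow> (nat \<Rightarrow> nat) \<Rightarrow> bool" where
  "neighbors p q \<longleftrightarrow> l1_dist (\<lambda>i. real (p i)) (\<lambda>i. real (q i)) \<le> 1"

text \<open>A randomized algorithm is identified with the family of its output distributions. The
  product sigma-algebra is the least one making all coordinates measurable; an algorithm whose
  outputs live on a finer sigma-algebra restricts to one of these without affecting its privacy
  or its error. The values of \<open>A\<close> outside \<^const>\<open>int_partitions\<close> are irrelevant.\<close>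

abbreviation real_seq_space :: "(nat \<Rightarrow> real) measure" where
  "real_seq_space \<equiv> Pi\<^sub>M UNIV (\<lambda>_. borel)"

definition randomized_algorithm :: "((nat \<Rightarrow> nat) \<Rightarrow> (nat \<Rightarrow> real) measure) \<Rightarrow> bool" where
  "randomized_algorithm A \<longleftrightarrow>
     (\<forall>p\<in>int_partitions. prob_space (A p) \<and> sets (A p) = sets real_seq_space)"

definition differentially_private ::
    "real \<Rightarrow> real \<Rightarrow> ((nat \<Rightarrow> nat) \<Rightarrow> (nat \<Rightarrow> real) measure) \<Rightarrow> bool" where
  "differentially_private \<epsilon> \<delta> A \<longleftrightarrow>
     (\<forall>p\<in>int_partitions. \<forall>q\<in>int_partitions. neighbors p q \<longrightarrow>
        (\<forall>S\<in>sets real_seq_space. measure (A p) S \<le> exp \<epsilon> * measure (A q) S + \<delta>))"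

text \<open>The supremum is a maximum, because there are finitely many partitions of size at most
  \<open>n\<close>; an infinite expected error is represented by \<open>\<infinity>\<close>.\<close>

definition partition_error :: "((nat \<Rightarrow> nat) \<Rightarrow> (nat \<Rightarrow> real) measure) \<Rightarrow> nat \<Rightarrow> ennreal" where
  "partition_error A n =
     (SUP p\<in>int_partitions_le n. \<integral>\<^sup>+ v. l1_dist v (\<lambda>i. real (p i)) \<partial>A p)"

text \<open>The lower bound is stated for \<open>n \<ge> 2\<close>. For \<open>n = 1\<close> we have \<open>log 2 n / n = 0\<close>, so that
  every small positive \<open>\<epsilon>\<close> would be allowed, but the algorithm that always outputs the zero
  sequence is private with error \<open>1\<close>, whereas the claimed bound is unbounded as \<open>\<epsilon>\<close> tends
  to \<open>0\<close>.\<close>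

end

theory Submission
  imports Defs
begin

text \<open>Fix \<open>L\<close> with \<open>2\<^sup>L \<approx> 1 / (8 \<epsilon>)\<close> and consider a hyperbola-like staircase whose steps are
  rectangles of width \<open>2\<^sup>g\<close> and height \<open>2 ^ (L - g)\<close>, with \<open>k\<close> steps for each \<open>g = 0, \<dots>, L\<close>.
  Each of the \<open>M = k (L + 1)\<close> outer rectangles can be filled or left empty independently of the
  others. Filling one of them takes \<open>2\<^sup>L\<close> moves between neighbors, so by group privacy the
  algorithm can hardly tell the two states apart and, on average over all \<open>2 ^ M\<close> partitions,
  incurs error \<open>\<Omega>(2\<^sup>L)\<close> on the columns of each rectangle. The partitions have size at most
  \<open>2 k\<^sup>2 (L + 1) 2\<^sup>L\<close>, so that \<open>k \<approx> sqrt (n \<epsilon> / log (1 / \<epsilon>))\<close> is admissible, and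
  the total error is \<open>\<Omega>(M 2\<^sup>L)\<close>.\<close>

section \<open>Group privacy\<close>

lemma partition_fun_upd_Suc:
  assumes "p \<in> int_partitions" "\<And>j. j < i \<Longrightarrow> p i < p j"
  shows "p(i := Suc (p i)) \<in> int_partitions"
proof -
  have "antimono p" "finite {j. p j \<noteq> 0}"
    using assms(1) by (auto simp: int_partitions_def)
  have "antimono (p(i := Suc (p i)))"
  proof (rule antimonoI)
    fix x y :: nat
    assume "x \<le> y"
    then show "(p(i := Suc (p i))) y \<le> (p(i := Suc (p i))) x"
      using antimonoD[OF \<open>antimono p\<close> \<open>x \<le> y\<close>] assms(2)[of x] by auto
  qed
  moreover have "finite {j. (p(i := Suc (p i))) j \<noteq> 0}"
    by (rule finite_subset[of _ "insert i {j. p j \<noteq> 0}"]) (use \<open>finite {j. p j \<noteq> 0}\<close> in auto)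
  ultimately show ?thesis
    by (simp add: int_partitions_def)
qed

lemma neighbors_fun_upd_Suc: "neighbors (p(i := Suc (p i))) p"
proof -
  have "l1_dist (\<lambda>j. real ((p(i := Suc (p i))) j)) (\<lambda>j. real (p j)) =
      (\<Sum>j\<in>{i}. ennreal \<bar>real ((p(i := Suc (p i))) j) - real (p j)\<bar>)"
    unfolding l1_dist_def by (rule suminf_finite) auto
  then show ?thesis
    by (simp add: neighbors_def)
qed

text \<open>Unit increments lead from \<open>p\<close> to \<open>q\<close> through partitions, each
  costing a factor \<open>exp \<epsilon>\<close> and an additive \<delta>. The term
  \<open>\<delta> * real d\<close> is coarser than the geometric sum of the additive losses, but
  passes easily through the induction.\<close>

lemma group_privacy:
  assumes dp: "differentially_private \<epsilon> \<delta> A" and "0 \<le> \<epsilon>" "0 \<le> \<delta>"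
    and S: "S \<in> sets real_seq_space"
    and "finite I" "p \<in> int_partitions" "q \<in> int_partitions"
    and "p \<le> q" "\<And>i. i \<notin> I \<Longrightarrow> p i = q i" "(\<Sum>i\<in>I. q i - p i) = d"
  shows "measure (A q) S \<le> exp (\<epsilon> * real d) * (measure (A p) S + \<delta> * real d)"
  using assms(6-)
proof (induction d arbitrary: p)
  case 0
  have "p i = q i" for i
    using 0(4,5) le_funD[OF 0(3), of i] \<open>finite I\<close> by (cases "i \<in> I") auto
  then have "p = q"
    by blast
  then show ?case
    by simp
next
  case (Suc d)
  have "\<exists>i. p i < q i"
  proof (rule ccontr)
    assume "\<nexists>i. p i < q i"
    then have "(\<Sum>i\<in>I. q i - p i) = 0"
      by (simp add: not_less)
    with Suc.prems(5) show False
      by simp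
  qed
  \<comment> \<open>Incrementing the first deficient column preserves monotonicity: every earlier
    column already agrees with \<open>q\<close>, so its height is at least
    \<open>q i > p i\<close>.\<close>
  define i where "i = (LEAST i. p i < q i)"
  have i: "p i < q i"
    unfolding i_def using \<open>\<exists>i. p i < q i\<close> by (rule LeastI_ex)
  have least: "p j = q j" if "j < i" for j
    using not_less_Least[OF that[unfolded i_def]] le_funD[OF Suc.prems(3), of j] by simp
  define p' where "p' = p(i := Suc (p i))"
  have p': "p' \<in> int_partitions"
    unfolding p'_def
  proof (rule partition_fun_upd_Suc)
    fix j
    assume "j < i"
    then have "q i \<le> q j"
      using Suc.prems(2) by (simp add: int_partitions_def antimonoD)
    then show "p i < p j"
      using i least[OF \<open>j < i\<close>] by simp
  qed fact
  have "i \<in> I"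
    using i Suc.prems(4)[of i] by (cases "i \<in> I") auto
  have "(\<Sum>j\<in>I. q j - p' j) = d"
  proof -
    have "(\<Sum>j\<in>I. q j - p j) = (q i - p i) + (\<Sum>j\<in>I - {i}. q j - p j)"
      using \<open>finite I\<close> \<open>i \<in> I\<close> by (rule sum.remove)
    moreover have "(\<Sum>j\<in>I. q j - p' j) = (q i - p' i) + (\<Sum>j\<in>I - {i}. q j - p' j)"
      using \<open>finite I\<close> \<open>i \<in> I\<close> by (rule sum.remove)
    moreover have "(\<Sum>j\<in>I - {i}. q j - p' j) = (\<Sum>j\<in>I - {i}. q j - p j)"
      by (rule sum.cong) (auto simp: p'_def)
    ultimately show ?thesis
      using Suc.prems(5) i by (simp add: p'_def)
  qed
  moreover have "p' \<le> q"
    using Suc.prems(3) i by (auto simp: le_fun_def p'_def)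
  moreover have "p' j = q j" if "j \<notin> I" for j
    using that \<open>i \<in> I\<close> Suc.prems(4) by (auto simp: p'_def)
  ultimately have "measure (A q) S \<le> exp (\<epsilon> * real d) * (measure (A p') S + \<delta> * real d)"
    using Suc.IH[OF p' Suc.prems(2)] by blast
  also have "measure (A p') S \<le> exp \<epsilon> * measure (A p) S + \<delta>"
    using dp p' Suc.prems(1) S neighbors_fun_upd_Suc[of p i]
    unfolding differentially_private_def p'_def by blast
  also have "exp \<epsilon> * measure (A p) S + \<delta> + \<delta> * real d \<le>
      exp \<epsilon> * (measure (A p) S + \<delta> * real (Suc d))"
    using mult_right_mono[of 1 "exp \<epsilon>" "\<delta> * real (Suc d)"] \<open>0 \<le> \<epsilon>\<close> \<open>0 \<le> \<delta>\<close>
    by (simp add: algebra_simps)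
  finally show ?case
    by (simp add: exp_add algebra_simps)
qed

section \<open>Staircases\<close>

text \<open>The rectangle \<open>c\<close> has height \<open>h c\<close> and occupies the columns \<open>{W c..<W (Suc c)}\<close>; it is
  filled iff \<open>c \<in> T\<close>.\<close>

definition staircase :: "nat \<Rightarrow> (nat \<Rightarrow> nat) \<Rightarrow> (nat \<Rightarrow> nat) \<Rightarrow> nat set \<Rightarrow> nat \<Rightarrow> nat" where
  "staircase M h W T i = (\<Sum>c<M. if i < (if c \<in> T then W (Suc c) else W c) then h c else 0)"

lemma staircase_support:
  assumes "mono W"
  shows "{i. staircase M h W T i \<noteq> 0} \<subseteq> {..<W M}"
proof -
  have "staircase M h W T i = 0" if "W M \<le> i" for i
    unfolding staircase_def
  proof (rule sum.neutral, rule ballI)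
    fix c
    assume "c \<in> {..<M}"
    then have "W c \<le> W M" "W (Suc c) \<le> W M"
      by (simp_all add: monoD[OF \<open>mono W\<close>])
    then show "(if i < (if c \<in> T then W (Suc c) else W c) then h c else 0) = 0"
      using that by auto
  qed
  then show ?thesis
    by (intro subsetI) (metis lessThan_iff mem_Collect_eq not_le)
qed

lemma staircase_partition:
  assumes "mono W"
  shows "staircase M h W T \<in> int_partitions"
proof -
  have "finite {i. staircase M h W T i \<noteq> 0}"
    using staircase_support[OF assms] by (rule finite_subset) simp
  moreover have "antimono (staircase M h W T)"
    by (rule antimonoI) (auto simp: staircase_def intro!: sum_mono)
  ultimately show ?thesis
    by (simp add: int_partitions_def)
qed

text \<open>Each \<open>c\<close> contributes a horizontal layer of height \<open>h c\<close>, at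
  most \<open>W (Suc c)\<close> wide even if rectangle \<open>c\<close> is filled. Summing by layers
  instead of columns bounds all fillings at once.\<close>

lemma staircase_size:
  assumes "mono W"
  shows "partition_size (staircase M h W T) \<le> (\<Sum>c<M. h c * W (Suc c))"
proof -
  have "partition_size (staircase M h W T) = (\<Sum>i<W M. staircase M h W T i)"
    unfolding partition_size_def
    using staircase_support[OF assms] by (intro sum.mono_neutral_left) auto
  also have "\<dots> = (\<Sum>c<M. \<Sum>i<W M. if i < (if c \<in> T then W (Suc c) else W c) then h c else 0)"
    unfolding staircase_def by (rule sum.swap)
  also have "\<dots> \<le> (\<Sum>c<M. h c * W (Suc c))"
  proof (rule sum_mono)
    fix c
    have "(\<Sum>i<W M. if i < (if c \<in> T then W (Suc c) else W c) then h c else 0) \<le>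
        (\<Sum>i<W M. if i \<in> {..<W (Suc c)} then h c else 0)"
      using monoD[OF \<open>mono W\<close>, of c "Suc c"] by (intro sum_mono) auto
    also have "\<dots> = (\<Sum>i\<in>{..<W M} \<inter> {..<W (Suc c)}. h c)"
      by (rule sum.inter_restrict[symmetric]) simp
    also have "\<dots> \<le> (\<Sum>i\<in>{..<W (Suc c)}. h c)"
      by (rule sum_mono2) auto
    finally show "(\<Sum>i<W M. if i < (if c \<in> T then W (Suc c) else W c) then h c else 0) \<le>
        h c * W (Suc c)"
      by (simp add: mult.commute)
  qed
  finally show ?thesis .
qed

lemma staircase_insert:
  assumes "mono W" "c < M" "c \<notin> T"
  shows "staircase M h W (insert c T) i =
    staircase M h W T i + (if i \<in> {W c..<W (Suc c)} then h c else 0)"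
proof -
  have "staircase M h W U i = (if i < (if c \<in> U then W (Suc c) else W c) then h c else 0) +
      (\<Sum>b\<in>{..<M} - {c}. if i < (if b \<in> U then W (Suc b) else W b) then h b else 0)" for U
    unfolding staircase_def using \<open>c < M\<close> by (intro sum.remove) auto
  moreover have
    "(\<Sum>b\<in>{..<M} - {c}. if i < (if b \<in> insert c T then W (Suc b) else W b) then h b else 0) =
     (\<Sum>b\<in>{..<M} - {c}. if i < (if b \<in> T then W (Suc b) else W b) then h b else 0)"
    by (rule sum.cong) auto
  ultimately show ?thesis
    using \<open>c \<notin> T\<close> monoD[OF \<open>mono W\<close>, of c "Suc c"] by auto
qed

section \<open>The error on the columns of one rectangle\<close>

definition block_error :: "nat set \<Rightarrow> (nat \<Rightarrow> nat) \<Rightarrow> (nat \<Rightarrow> real) \<Rightarrow> real" where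
  "block_error I p v = (\<Sum>i\<in>I. \<bar>v i - real (p i)\<bar>)"

lemma block_error_measurable: "block_error I p \<in> borel_measurable real_seq_space"
  unfolding block_error_def by measurable

lemma block_error_nonneg: "0 \<le> block_error I p v"
  by (simp add: block_error_def sum_nonneg)

text \<open>Le Cam's two-point argument: let \<open>S\<close> be the event that \<open>f\<close> is
  at least \<open>D / 2\<close>. Then \<open>f\<close> pays \<open>D / 2\<close> on \<open>S\<close>
  under \<open>M0\<close>, and \<open>g\<close> pays it off \<open>S\<close> under
  \<open>M1\<close>. By closeness these two probabilities sum to at least 1/2.\<close>

lemma two_point_lower_bound:
  assumes M: "prob_space M0" "prob_space M1"
    and sets: "sets M0 = sets N" "sets M1 = sets N"
    and f: "f \<in> borel_measurable N" and g: "g \<in> borel_measurable N"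
    and nonneg: "\<And>v. 0 \<le> f v" "\<And>v. 0 \<le> g v"
    and fg: "\<And>v. D \<le> f v + g v" and "0 \<le> D"
    and close: "\<And>S. S \<in> sets N \<Longrightarrow> measure M1 S \<le> measure M0 S + 1 / 2"
  shows "ennreal (D / 4) \<le> (\<integral>\<^sup>+ v. ennreal (f v) \<partial>M0) + (\<integral>\<^sup>+ v. ennreal (g v) \<partial>M1)"
proof -
  interpret M0: prob_space M0 by fact
  interpret M1: prob_space M1 by fact
  have space: "space M0 = space N" "space M1 = space N"
    using sets by (auto dest: sets_eq_imp_space_eq)
  define S where "S = {v \<in> space N. D / 2 \<le> f v}"
  have S: "S \<in> sets N"
    unfolding S_def using f by measurable
  have "ennreal (D / 2) * emeasure M0 S = (\<integral>\<^sup>+ v. ennreal (D / 2) * indicator S v \<partial>M0)"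
    using S sets by (simp add: nn_integral_cmult_indicator)
  also have "\<dots> \<le> (\<integral>\<^sup>+ v. ennreal (f v) \<partial>M0)"
    by (intro nn_integral_mono) (auto simp: S_def indicator_def intro: ennreal_leI)
  finally have M0: "ennreal (D / 2 * measure M0 S) \<le> (\<integral>\<^sup>+ v. ennreal (f v) \<partial>M0)"
    using \<open>0 \<le> D\<close> by (subst ennreal_mult) (simp_all add: M0.emeasure_eq_measure)
  have "ennreal (D / 2) * emeasure M1 (space N - S) =
      (\<integral>\<^sup>+ v. ennreal (D / 2) * indicator (space N - S) v \<partial>M1)"
    using S sets by (simp add: nn_integral_cmult_indicator)
  also have "\<dots> \<le> (\<integral>\<^sup>+ v. ennreal (g v) \<partial>M1)"
  proof (rule nn_integral_mono)
    fix v
    show "ennreal (D / 2) * indicator (space N - S) v \<le> ennreal (g v)"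
      using fg[of v] by (auto simp: S_def indicator_def intro!: ennreal_leI)
  qed
  finally have M1: "ennreal (D / 2 * measure M1 (space N - S)) \<le> (\<integral>\<^sup>+ v. ennreal (g v) \<partial>M1)"
    using \<open>0 \<le> D\<close> by (subst ennreal_mult) (simp_all add: M1.emeasure_eq_measure)
  have "measure M1 (space N - S) = 1 - measure M1 S"
    using M1.prob_compl[of S] S sets space by simp
  with close[OF S] have "1 / 2 \<le> measure M0 S + measure M1 (space N - S)"
    by simp
  then have "D / 2 * (1 / 2) \<le> D / 2 * (measure M0 S + measure M1 (space N - S))"
    using \<open>0 \<le> D\<close> by (intro mult_left_mono) auto
  then have "ennreal (D / 4) \<le>
      ennreal (D / 2 * measure M0 S + D / 2 * measure M1 (space N - S))"
    by (intro ennreal_leI) (simp add: distrib_left)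
  also have "\<dots> = ennreal (D / 2 * measure M0 S) + ennreal (D / 2 * measure M1 (space N - S))"
    using \<open>0 \<le> D\<close> by (intro ennreal_plus) auto
  also have "\<dots> \<le> (\<integral>\<^sup>+ v. ennreal (f v) \<partial>M0) + (\<integral>\<^sup>+ v. ennreal (g v) \<partial>M1)"
    by (rule add_mono[OF M0 M1])
  finally show ?thesis .
qed

text \<open>The blocks are consecutive and disjoint, so their errors form a finite part of the
  series.\<close>

lemma sum_block_error_le_l1_dist:
  assumes "mono W"
  shows "(\<Sum>c<M. ennreal (block_error {W c..<W (Suc c)} p v)) \<le> l1_dist v (\<lambda>i. real (p i))"
proof -
  have "(\<Sum>c<M. \<Sum>i\<in>{W c..<W (Suc c)}. \<bar>v i - real (p i)\<bar>) =
      (\<Sum>i\<in>{W 0..<W M}. \<bar>v i - real (p i)\<bar>)"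
  proof (induction M)
    case (Suc M)
    have "W 0 \<le> W M" "W M \<le> W (Suc M)"
      using monoD[OF assms] by auto
    then show ?case
      using Suc by (simp add: sum.atLeastLessThan_concat)
  qed simp
  then have "(\<Sum>c<M. ennreal (block_error {W c..<W (Suc c)} p v)) =
      (\<Sum>i\<in>{W 0..<W M}. ennreal \<bar>v i - real (p i)\<bar>)"
    by (simp add: block_error_def sum_ennreal sum_nonneg)
  also have "\<dots> \<le> l1_dist v (\<lambda>i. real (p i))"
    unfolding l1_dist_def by (rule sum_le_suminf) auto
  finally show ?thesis .
qed

text \<open>The two partitions differ by as many unit moves as the rectangle has cells. This is few
  enough that, by group privacy, filling it raises no event's probability by more than 1/2; yet by
  the triangle inequality no output is close to both.\<close>

lemma staircase_pair_error:
  assumes A: "randomized_algorithm A" "differentially_private \<epsilon> \<delta> A"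
    and \<epsilon>: "0 < \<epsilon>" "0 \<le> \<delta>" "\<delta> \<le> \<epsilon> / 10"
    and "mono W" "c < M" "c \<notin> T"
    and area: "\<epsilon> * real (h c * (W (Suc c) - W c)) \<le> 1 / 8"
  shows "ennreal (real (h c * (W (Suc c) - W c)) / 4) \<le>
      (\<integral>\<^sup>+ v. ennreal (block_error {W c..<W (Suc c)} (staircase M h W T) v)
         \<partial>A (staircase M h W T)) +
      (\<integral>\<^sup>+ v. ennreal (block_error {W c..<W (Suc c)} (staircase M h W (insert c T)) v)
         \<partial>A (staircase M h W (insert c T)))"
proof -
  define I where "I = {W c..<W (Suc c)}"
  define d where "d = h c * (W (Suc c) - W c)"
  define p where "p = staircase M h W T"
  define q where "q = staircase M h W (insert c T)"
  have q_eq: "q i = p i + (if i \<in> I then h c else 0)" for i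
    unfolding p_def q_def I_def using staircase_insert[OF \<open>mono W\<close> \<open>c < M\<close> \<open>c \<notin> T\<close>] .
  have pq: "p \<in> int_partitions" "q \<in> int_partitions"
    unfolding p_def q_def using staircase_partition[OF \<open>mono W\<close>] by auto
  have "measure (A q) S \<le> measure (A p) S + 1 / 2" if S: "S \<in> sets real_seq_space" for S
  proof -
    interpret prob_space "A p"
      using A(1) pq by (simp add: randomized_algorithm_def)
    have "(\<Sum>i\<in>I. q i - p i) = d"
      by (simp add: q_eq d_def I_def mult.commute)
    then have "measure (A q) S \<le> exp (\<epsilon> * real d) * (measure (A p) S + \<delta> * real d)"
      using \<epsilon> pq S by (intro group_privacy[where I = I, OF A(2)]) (auto simp: q_eq le_fun_def I_def)
    \<comment> \<open>From \<open>\<epsilon> * d \<le> 1 / 8\<close> follow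
      \<open>exp (- \<epsilon> * d) \<ge> 7 / 8\<close> and
      \<open>\<delta> * d \<le> \<epsilon> * d / 10 \<le> 1 / 80\<close>.\<close>
    also have "\<dots> \<le> 8 / 7 * (measure (A p) S + 1 / 80)"
    proof (rule mult_mono)
      have "7 / 8 \<le> exp (- (\<epsilon> * real d))"
        using exp_ge_add_one_self[of "- (\<epsilon> * real d)"] area by (simp add: d_def)
      then show "exp (\<epsilon> * real d) \<le> 8 / 7"
        by (simp add: exp_minus field_simps)
      have "\<delta> * real d \<le> \<epsilon> / 10 * real d"
        using \<epsilon> by (intro mult_right_mono) auto
      then show "measure (A p) S + \<delta> * real d \<le> measure (A p) S + 1 / 80"
        using area by (simp add: d_def)
    qed (use \<epsilon> in auto)
    \<comment> \<open>A probability is at most 1, so the excess is at most 1/7 + 1/70.\<close>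
    also have "\<dots> \<le> measure (A p) S + 1 / 2"
      using prob_le_1[of S] by (simp del: prob_le_1)
    finally show ?thesis .
  qed
  moreover have "real d \<le> block_error I p v + block_error I q v" for v
  proof -
    have "real d = (\<Sum>i\<in>I. real (h c))"
      by (simp add: d_def I_def mult.commute)
    also have "\<dots> \<le> (\<Sum>i\<in>I. \<bar>v i - real (p i)\<bar> + \<bar>v i - real (q i)\<bar>)"
      by (rule sum_mono) (simp add: q_eq)
    finally show ?thesis
      by (simp add: block_error_def sum.distrib)
  qed
  ultimately have "ennreal (real d / 4) \<le>
      (\<integral>\<^sup>+ v. ennreal (block_error I p v) \<partial>A p) + (\<integral>\<^sup>+ v. ennreal (block_error I q v) \<partial>A q)"
    using A(1) pq block_error_nonneg block_error_measurable
    by (intro two_point_lower_bound[where N = real_seq_space])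
      (auto simp: randomized_algorithm_def)
  then show ?thesis
    by (simp add: d_def I_def p_def q_def)
qed

section \<open>Averaging over all fillings\<close>

text \<open>Toggling \<open>c\<close> is an involution of \<open>Pow C\<close>. Counting each pair
  from both sides keeps all sums over the whole of \<open>Pow C\<close>, whence the factor
  2.\<close>

lemma sum_Pow_pairs_ge:
  fixes f :: "nat set \<Rightarrow> ennreal"
  assumes "finite C" "c \<in> C"
    and pair: "\<And>T. T \<subseteq> C \<Longrightarrow> c \<notin> T \<Longrightarrow> x \<le> f T + f (insert c T)"
  shows "2 ^ card C * x \<le> 2 * (\<Sum>T\<in>Pow C. f T)"
proof -
  define flip where "flip T = (if c \<in> T then T - {c} else insert c T)" for T
  have "(\<Sum>T\<in>Pow C. f T) = (\<Sum>T\<in>Pow C. f (flip T))"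
    by (rule sum.reindex_bij_witness[of _ flip flip])
      (use \<open>c \<in> C\<close> in \<open>auto simp: flip_def insert_absorb\<close>)
  then have "2 * (\<Sum>T\<in>Pow C. f T) = (\<Sum>T\<in>Pow C. f T + f (flip T))"
    by (simp add: mult_2 sum.distrib)
  moreover have "x \<le> f T + f (flip T)" if "T \<subseteq> C" for T
  proof (cases "c \<in> T")
    case True
    have "x \<le> f (T - {c}) + f (insert c (T - {c}))"
      using that by (intro pair) auto
    also have "\<dots> = f T + f (flip T)"
      using True by (simp add: flip_def insert_absorb add.commute)
    finally show ?thesis .
  qed (use pair[OF that] in \<open>simp add: flip_def\<close>)
  ultimately show ?thesis
    using sum_mono[of "Pow C" "\<lambda>_. x" "\<lambda>T. f T + f (flip T)"] \<open>finite C\<close> by (simp add: card_Pow)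
qed

text \<open>The maximal error dominates the average over the \<open>2 ^ M\<close> fillings. In that
  average each rectangle contributes at least \<open>a / 8\<close>, half of the \<open>a / 4\<close>
  guaranteed for two fillings that differ only in it.\<close>

lemma staircase_error:
  assumes A: "randomized_algorithm A" "differentially_private \<epsilon> \<delta> A"
    and \<epsilon>: "0 < \<epsilon>" "0 \<le> \<delta>" "\<delta> \<le> \<epsilon> / 10"
    and "mono W"
    and area: "\<And>c. c < M \<Longrightarrow> h c * (W (Suc c) - W c) = a" "\<epsilon> * real a \<le> 1 / 8"
    and size: "(\<Sum>c<M. h c * W (Suc c)) \<le> n"
  shows "ennreal (real (M * a) / 8) \<le> partition_error A n"
proof (cases "partition_error A n")
  case (real r)
  define F where "F c T = (\<integral>\<^sup>+ v. ennreal (block_error {W c..<W (Suc c)} (staircase M h W T) v)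
    \<partial>A (staircase M h W T))" for c T
  have "(\<Sum>c<M. F c T) \<le> ennreal r" for T
  proof -
    define p where "p = staircase M h W T"
    have p: "p \<in> int_partitions" "p \<in> int_partitions_le n"
      using staircase_partition[OF \<open>mono W\<close>, of M h T]
        order_trans[OF staircase_size[OF \<open>mono W\<close>, of M h T] size]
      by (auto simp: int_partitions_le_def p_def)
    have [measurable_cong]: "sets (A p) = sets real_seq_space"
      using A(1) p by (simp add: randomized_algorithm_def)
    note [measurable] = block_error_measurable
    have "(\<Sum>c<M. F c T) = (\<integral>\<^sup>+ v. (\<Sum>c<M. ennreal (block_error {W c..<W (Suc c)} p v)) \<partial>A p)"
      unfolding F_def p_def[symmetric] by (rule nn_integral_sum[symmetric]) measurable
    also have "\<dots> \<le> (\<integral>\<^sup>+ v. l1_dist v (\<lambda>i. real (p i)) \<partial>A p)"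
      by (intro nn_integral_mono sum_block_error_le_l1_dist \<open>mono W\<close>)
    also have "\<dots> \<le> partition_error A n"
      unfolding partition_error_def by (rule SUP_upper) fact
    finally show ?thesis
      using real by simp
  qed
  then have "(\<Sum>T\<in>Pow {..<M}. \<Sum>c<M. F c T) \<le> (\<Sum>T\<in>Pow {..<M}. ennreal r)"
    by (intro sum_mono)
  also have "\<dots> = ennreal (2 ^ M * r)"
    using real by (simp add: card_Pow ennreal_mult ennreal_power[symmetric])
  finally have upper: "(\<Sum>c<M. \<Sum>T\<in>Pow {..<M}. F c T) \<le> ennreal (2 ^ M * r)"
    by (subst sum.swap)
  have "2 ^ card {..<M} * ennreal (real a / 4) \<le> 2 * (\<Sum>T\<in>Pow {..<M}. F c T)" if "c < M" for c
  proof (rule sum_Pow_pairs_ge)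
    fix T
    assume "c \<notin> T"
    then show "ennreal (real a / 4) \<le> F c T + F c (insert c T)"
      unfolding F_def using staircase_pair_error[OF A \<epsilon> \<open>mono W\<close> that, of T h] area that by simp
  qed (use that in auto)
  then have "(\<Sum>c<M. 2 ^ M * ennreal (real a / 4)) \<le> (\<Sum>c<M. 2 * (\<Sum>T\<in>Pow {..<M}. F c T))"
    by (intro sum_mono) simp
  also have "\<dots> = 2 * (\<Sum>c<M. \<Sum>T\<in>Pow {..<M}. F c T)"
    by (simp add: sum_distrib_left)
  also have "\<dots> \<le> 2 * ennreal (2 ^ M * r)"
    using upper by (rule mult_left_mono) simp
  finally have "ennreal (real M * (2 ^ M * (real a / 4))) \<le> ennreal (2 * (2 ^ M * r))"
    using real by (simp add: ennreal_mult ennreal_power[symmetric] ennreal_of_nat_eq_real_of_nat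
        del: times_divide_eq_right)
  then have "real M * (2 ^ M * (real a / 4)) \<le> 2 * (2 ^ M * r)"
    using real by (simp add: ennreal_le_iff)
  then have "real (M * a) / 8 \<le> r"
    by (simp add: field_simps)
  then show ?thesis
    using real by (simp add: ennreal_leI)
qed simp

section \<open>The hyperbolic staircase\<close>

text \<open>The exponent is constant on blocks of length \<open>k\<close>, so rounding up to full
  blocks leaves \<open>k\<close> times a geometric sum. For steps of these widths, all columns up to
  step \<open>c\<close> number at most \<open>2 * k\<close> times the width of that step.\<close>

lemma sum_power_div_le:
  fixes k c :: nat
  assumes "0 < k"
  shows "(\<Sum>b<Suc c. 2 ^ (b div k)) \<le> k * 2 ^ Suc (c div k)" (is "?l \<le> (?r :: nat)")
proof -
  define m where "m = Suc (c div k)"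
  have "Suc c \<le> m * k"
    using dividend_less_div_times[OF assms, of c] by (simp add: m_def)
  then have "?l \<le> (\<Sum>b<m * k. 2 ^ (b div k))"
    by (intro sum_mono2) auto
  also have "\<dots> \<le> k * 2 ^ m"
  proof (induction m)
    case (Suc m)
    have "(\<Sum>b<Suc m * k. 2 ^ (b div k) :: nat) =
        (\<Sum>b<m * k. 2 ^ (b div k)) + (\<Sum>b\<in>{m * k..<m * k + k}. 2 ^ (b div k))"
      unfolding lessThan_atLeast0
      by (subst sum.atLeastLessThan_concat) (auto simp: add.commute)
    also have "(\<Sum>b\<in>{m * k..<m * k + k}. 2 ^ (b div k)) = (\<Sum>b\<in>{m * k..<m * k + k}. 2 ^ m :: nat)"
    proof (rule sum.cong)
      fix b
      assume "b \<in> {m * k..<m * k + k}"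
      then have "b div k = m"
        by (intro div_nat_eqI) (auto simp: mult.commute)
      then show "2 ^ (b div k) = (2 ^ m :: nat)"
        by simp
    qed simp
    finally show ?case
      using Suc by simp
  qed simp
  finally show ?thesis
    by (simp add: m_def)
qed

text \<open>Since the columns up to a rectangle number at most \<open>2 * k\<close> times its width,
  every layer has at most \<open>2 * k * 2 ^ L\<close> cells, whatever its height. The
  \<open>Suc L\<close> scales thus cost equally much, and they produce the logarithmic
  factor.\<close>

lemma partition_error_ge:
  assumes A: "randomized_algorithm A" "differentially_private \<epsilon> \<delta> A"
    and \<epsilon>: "0 < \<epsilon>" "0 \<le> \<delta>" "\<delta> \<le> \<epsilon> / 10"
    and area: "\<epsilon> * 2 ^ L \<le> 1 / 8"
    and size: "2 * k\<^sup>2 * Suc L * 2 ^ L \<le> n"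
    and "0 < k"
  shows "ennreal (real (k * Suc L * 2 ^ L) / 8) \<le> partition_error A n"
proof (rule staircase_error[OF A \<epsilon>])
  let ?W = "\<lambda>c. \<Sum>b<c. 2 ^ (b div k) :: nat"
  let ?h = "\<lambda>c. 2 ^ (L - c div k) :: nat"
  \<comment> \<open>Keeps the truncated subtraction in \<open>?h\<close> exact, so that each area is
    \<open>2 ^ L\<close>.\<close>
  have L: "c div k \<le> L" if "c < k * Suc L" for c
    using less_mult_imp_div_less[of c "Suc L" k] that by (simp add: mult.commute)
  show "mono ?W"
    by (intro monoI sum_mono2) auto
  show "?h c * (?W (Suc c) - ?W c) = 2 ^ L" if "c < k * Suc L" for c
    using L[OF that] by (simp add: power_add[symmetric])
  show "\<epsilon> * real (2 ^ L) \<le> 1 / 8"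
    using area by simp
  have "(\<Sum>c<k * Suc L. ?h c * ?W (Suc c)) \<le> (\<Sum>c<k * Suc L. k * 2 ^ Suc L)"
  proof (rule sum_mono)
    fix c
    assume c: "c \<in> {..<k * Suc L}"
    have "?h c * ?W (Suc c) \<le> ?h c * (k * 2 ^ Suc (c div k))"
      by (intro mult_left_mono sum_power_div_le \<open>0 < k\<close>) simp
    also have "\<dots> = k * 2 ^ Suc L"
      using L[of c] c by (simp add: power_add[symmetric])
    finally show "?h c * ?W (Suc c) \<le> k * 2 ^ Suc L" .
  qed
  also have "\<dots> = 2 * k\<^sup>2 * Suc L * 2 ^ L"
    by (simp add: power2_eq_square algebra_simps)
  also have "\<dots> \<le> n"
    by fact
  finally show "(\<Sum>c<k * Suc L. ?h c * ?W (Suc c)) \<le> n" .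
qed

theorem theorem2:
  "\<exists>c::real. c > 0 \<and>
     (\<forall>(n::nat) (\<epsilon>::real) (\<delta>::real) A.
        n \<ge> 2 \<and> log 2 (real n) / real n < \<epsilon> \<and> \<epsilon> < 1 / 10 ^ 6 \<and> 0 < \<delta> \<and> \<delta> < \<epsilon> / 10 \<and>
        randomized_algorithm A \<and> differentially_private \<epsilon> \<delta> A \<longrightarrow>
        partition_error A n \<ge> ennreal (c * sqrt (real n / \<epsilon> * log 2 (1 / \<epsilon>))))"
proof (intro exI[of _ "1 / 128"] conjI allI impI; (elim conjE)?)
  fix n :: nat and \<epsilon> \<delta> :: real and A
  assume n: "2 \<le> n" "log 2 (real n) / real n < \<epsilon>" and \<epsilon>: "\<epsilon> < 1 / 10 ^ 6"
    and \<delta>: "0 < \<delta>" "\<delta> < \<epsilon> / 10"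
    and A: "randomized_algorithm A" "differentially_private \<epsilon> \<delta> A"
  have "0 < \<epsilon>"
    using \<delta> by simp
  define l where "l = log 2 (1 / \<epsilon>)"
  \<comment> \<open>The value 6 ensures \<open>l - 3 \<ge> l / 2\<close>, so the shift by 3 in
    \<open>L\<close> costs at most half of the logarithm.\<close>
  have l: "6 \<le> l"
  proof -
    have "2 powr 6 \<le> 1 / \<epsilon>"
      using \<epsilon> \<open>0 < \<epsilon>\<close> by (simp add: field_simps)
    then show ?thesis
      unfolding l_def using \<open>0 < \<epsilon>\<close> by (subst le_log_iff) auto
  qed
  \<comment> \<open>The lower bound on \<epsilon> serves to derive
    \<open>l \<le> log 2 n < n * \<epsilon>\<close>, which later makes \<open>s\<close> at least
    1.\<close>
  have "log 2 (real n) < real n * \<epsilon>"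
    using n by (simp add: field_simps)
  moreover have "1 \<le> log 2 (real n)"
    using n by (subst le_log_iff) auto
  ultimately have "1 / \<epsilon> < real n"
    using \<open>0 < \<epsilon>\<close> by (simp add: field_simps)
  then have "l \<le> log 2 (real n)"
    unfolding l_def using n \<open>0 < \<epsilon>\<close> by (subst log_le_cancel_iff) auto
  then have "l \<le> real n * \<epsilon>"
    using \<open>log 2 (real n) < real n * \<epsilon>\<close> by simp

  \<comment> \<open>The largest exponent with \<open>2 ^ L \<le> 1 / (8 * \<epsilon>)\<close>, the
    area that the group privacy estimate admits; rounding costs at most a factor 2.\<close>
  define L where "L = nat \<lfloor>l - 3\<rfloor>"
  have L: "real L \<le> l - 3" "l - 3 < real L + 1"
    using l unfolding L_def by linarith+
  have powl: "2 powr (l - 3) = 1 / (8 * \<epsilon>)" "2 powr (l - 4) = 1 / (16 * \<epsilon>)"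
    using \<open>0 < \<epsilon>\<close> by (auto simp: powr_diff l_def)
  have "2 powr real L \<le> 2 powr (l - 3)" "2 powr (l - 4) \<le> 2 powr real L"
    using L by auto
  then have area: "2 ^ L \<le> 1 / (8 * \<epsilon>)" "1 / (16 * \<epsilon>) \<le> 2 ^ L"
    unfolding powl by (simp_all add: powr_realpow)

  \<comment> \<open>In these terms the size bound is \<open>2 * k\<^sup>2 * B\<close> and the error
    bound \<open>k * B / 8\<close>.\<close>
  define B where "B = real (Suc L) * 2 ^ L"
  have "B \<le> l * (1 / (8 * \<epsilon>))"
    unfolding B_def using L l area by (intro mult_mono) auto
  also have "\<dots> \<le> real n / 8"
    using \<open>l \<le> real n * \<epsilon>\<close> \<open>0 < \<epsilon>\<close> by (simp add: field_simps)
  finally have "B \<le> real n / 8" .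
  have "l / 2 * (1 / (16 * \<epsilon>)) \<le> B"
    unfolding B_def using L l area \<open>0 < \<epsilon>\<close> by (intro mult_mono) auto
  then have Bl: "l / (32 * \<epsilon>) \<le> B"
    by simp
  have "0 < B"
    by (simp add: B_def)

  \<comment> \<open>The real solution of \<open>2 * s\<^sup>2 * B = n\<close>, the largest
    admissible \<open>k\<close> before rounding. As \<open>s \<ge> 1\<close>, its floor is at least
    \<open>s / 2\<close>.\<close>
  define s where "s = sqrt (real n / (2 * B))"
  have "1 \<le> s"
    unfolding s_def using \<open>B \<le> real n / 8\<close> \<open>0 < B\<close> by (simp add: field_simps)
  define k where "k = nat \<lfloor>s\<rfloor>"
  have k: "0 < k" "real k \<le> s" "s / 2 \<le> real k"
    using \<open>1 \<le> s\<close> le_floor_iff[of 1 s] unfolding k_def by linarith+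
  have "(real k)\<^sup>2 \<le> real n / (2 * B)"
    using power_mono[OF k(2), of 2] \<open>0 < B\<close> by (simp add: s_def)
  then have "real (2 * k\<^sup>2 * Suc L * 2 ^ L) \<le> real n"
    using \<open>0 < B\<close> by (simp add: B_def field_simps)
  then have size: "2 * k\<^sup>2 * Suc L * 2 ^ L \<le> n"
    by (simp only: of_nat_le_iff)
  \<comment> \<open>The constant collects the losses:
    \<open>s / 2 * B / 8 = sqrt (n * B / 512)\<close> and
    \<open>B \<ge> l / (32 * \<epsilon>)\<close>, with
    \<open>512 * 32 = 128\<^sup>2\<close>.\<close>
  have "1 / 128 * sqrt (real n / \<epsilon> * l) = sqrt (real n * (l / (32 * \<epsilon>)) / 512)"
  proof -
    have "1 / 128 * sqrt (real n / \<epsilon> * l) = sqrt ((1 / 128)\<^sup>2) * sqrt (real n / \<epsilon> * l)"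
      by simp
    also have "\<dots> = sqrt ((1 / 128)\<^sup>2 * (real n / \<epsilon> * l))"
      by (rule real_sqrt_mult[symmetric])
    also have "(1 / 128)\<^sup>2 * (real n / \<epsilon> * l) = real n * (l / (32 * \<epsilon>)) / 512"
      by (simp add: power2_eq_square)
    finally show ?thesis .
  qed
  also have "\<dots> \<le> sqrt (real n * B / 512)"
    using Bl by (intro real_sqrt_le_mono divide_right_mono mult_left_mono) auto
  also have "\<dots> = s / 2 * B / 8"
  proof (rule real_sqrt_unique)
    have "s\<^sup>2 = real n / (2 * B)"
      using \<open>0 < B\<close> by (simp add: s_def)
    then show "(s / 2 * B / 8)\<^sup>2 = real n * B / 512"
      using \<open>0 < B\<close> by (simp add: power_mult_distrib power_divide power2_eq_square field_simps)
  qed (use \<open>1 \<le> s\<close> \<open>0 < B\<close> in simp)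
  also have "\<dots> \<le> real k * B / 8"
    using k \<open>0 < B\<close> by (intro divide_right_mono mult_right_mono) auto
  also have "\<dots> = real (k * Suc L * 2 ^ L) / 8"
    by (simp add: B_def algebra_simps)
  finally have "ennreal (1 / 128 * sqrt (real n / \<epsilon> * l)) \<le> ennreal (real (k * Suc L * 2 ^ L) / 8)"
    by (rule ennreal_leI)
  also have "\<dots> \<le> partition_error A n"
    using \<open>0 < \<epsilon>\<close> \<delta> area(1) size k(1)
    by (intro partition_error_ge[OF A]) (auto simp: field_simps)
  finally show "ennreal (1 / 128 * sqrt (real n / \<epsilon> * log 2 (1 / \<epsilon>))) \<le> partition_error A n"
    by (simp add: l_def)
qed simp

end
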